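(* Let $n\ge 1$ and let $r$ be a positive integer with $r\le n$. Then Condition C1 is satisfied by a generic $n\times n$ matrix of rank $r$: the set of complex $n\times n$ matrices of rank $r$ satisfying Condition C1 is dense in the set of all complex $n\times n$ matrices of rank $r$.
   Context: For $u,v\in\mathbb{C}^n$, $u*v=(u_1v_1,\ldots,u_nv_n)$ is the coordinatewise product, $u^k$ is the coordinatewise $k$-th power, and $\Delta[u]$ is the diagonal $n\times n$ matrix with $(i,i)$ entry $u_i$. $\mathcal{M}_n$ is the set of complex $n\times n$ matrices. Define $$V_n=\{(y,z,A)\in\mathbb{C}^n\times\mathbb{C}^n\times\mathcal{M}_n:\ \det(Id+\Delta[(sz+ty)^2].A)=1\ \forall s,t\in\mathbb{C},\ z+A.(z^3+z*y^2)=0\}.$$ An $n\times n$ matrix $A$ satisfies Condition C1 if whenever $(y,z,A)\in V_n$ then $z=0$. *)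

theory Defs
  imports "HOL-Analysis.Analysis"
begin

(* On vectors, * and ^ act coordinatewise: they are the products u*v and powers u^k below.
   Matrices are nested vectors, so matrix product and identity are ** and mat 1, not * and 1. *)

definition diag_matrix :: "'a::zero ^ 'n \<Rightarrow> 'a ^ 'n ^ 'n"
  where "diag_matrix u = (\<chi> i j. if i = j then u $ i else 0)"

definition V :: "((complex ^ 'n) \<times> (complex ^ 'n) \<times> (complex ^ 'n ^ 'n)) set"
  where "V = {(y, z, A).
    (\<forall>s t. det (mat 1 + diag_matrix ((s *s z + t *s y) ^ 2) ** A) = 1) \<and>
    z + A *v (z ^ 3 + z * y ^ 2) = 0}"

definition condition_C1 :: "complex ^ 'n ^ 'n \<Rightarrow> bool"
  where "condition_C1 A \<longleftrightarrow> (\<forall>y z. (y, z, A) \<in> V \<longrightarrow> z = 0)"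

end

theory Submission
  imports Defs "HOL-Computational_Algebra.Fundamental_Theorem_Algebra"
begin

text \<open>
  The vector \<open>y\<close> is irrelevant: if \<open>(y, z, A) \<in> V\<close>, then \<open>z\<close> lies in the image of \<open>A\<close> and
  \<open>\<Delta>[z\<^sup>2] A\<close> is nilpotent, and already this forces \<open>z = 0\<close> for generic \<open>A\<close>.
  Write \<open>A = G D H\<close> with \<open>G\<close>, \<open>H\<close> invertible and \<open>D\<close> a diagonal 0/1 matrix, and move \<open>G\<close> and \<open>H\<close>
  along straight lines \<open>G\<^sub>t\<close>, \<open>H\<^sub>t\<close> to the identity. A vector in the image of
  \<open>A\<^sub>t = G\<^sub>t D H\<^sub>t\<close> is \<open>z = G\<^sub>t x\<close> with \<open>x = D x\<close>, and nilpotency of \<open>\<Delta>[z\<^sup>2] A\<^sub>t\<close> makes the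
  diagonal entries \<open>f\<^sub>i(t, x)\<close> of its \<open>n\<close>-th power vanish. These are forms in \<open>x\<close> of degree \<open>2n\<close>
  with coefficients polynomial in \<open>t\<close>, and \<open>f\<^sub>i(1, x) = x\<^sub>i\<^sup>2\<^sup>n\<close> on the support of \<open>D\<close>.
  By elimination they have a common nontrivial zero for only finitely many \<open>t\<close>, so \<open>A\<^sub>t\<close> satisfies
  Condition C1 for all small \<open>t \<noteq> 0\<close>, and \<open>A\<^sub>t\<close> has the rank of \<open>A\<close> for small \<open>t\<close>.
\<close>

section \<open>Elimination\<close>

lemma finite_poly_matrix_singular:
  fixes C :: "'a \<Rightarrow> 'a \<Rightarrow> 'b::field poly"
  assumes "finite S"
    and "\<And>\<alpha> \<beta>. \<alpha> \<in> S \<Longrightarrow> \<beta> \<in> S \<Longrightarrow> poly (C \<alpha> \<beta>) s = (if \<alpha> = \<beta> then 1 else 0)"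
  shows "finite {t. \<exists>v. (\<exists>\<alpha>\<in>S. v \<alpha> \<noteq> 0) \<and> (\<forall>\<alpha>\<in>S. (\<Sum>\<beta>\<in>S. poly (C \<alpha> \<beta>) t * v \<beta>) = 0)}"
  using assms
proof (induction S arbitrary: C rule: finite_induct)
  case empty
  then show ?case by simp
next
  case (insert b S)
  \<comment> \<open>Division-free Gaussian elimination; the pivot is nonzero at \<open>s\<close>, hence outside a finite set.\<close>
  define C' where "C' = (\<lambda>\<alpha> \<beta>. C b b * C \<alpha> \<beta> - C \<alpha> b * C b \<beta>)"
  define bad where "bad = {t. \<exists>v. (\<exists>\<alpha>\<in>S. v \<alpha> \<noteq> 0) \<and> (\<forall>\<alpha>\<in>S. (\<Sum>\<beta>\<in>S. poly (C' \<alpha> \<beta>) t * v \<beta>) = 0)}"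
  have "finite bad"
    unfolding bad_def
  proof (rule insert.IH)
    \<comment> \<open>At \<open>s\<close> the pivot is 1 and the entries \<open>C \<alpha> b\<close>
      vanish, so the reduced matrix is again the identity there.\<close>
    fix \<alpha> \<beta> assume "\<alpha> \<in> S" "\<beta> \<in> S"
    then show "poly (C' \<alpha> \<beta>) s = (if \<alpha> = \<beta> then 1 else 0)"
      using insert.prems insert.hyps by (auto simp: C'_def)
  qed
  have fin: "finite {t. poly (C b b) t = 0}"
    using insert.prems[of b b] by (intro poly_roots_finite) auto
  have "t \<in> bad"
    if nz: "\<exists>\<alpha>\<in>insert b S. v \<alpha> \<noteq> 0"
      and eq: "\<forall>\<alpha>\<in>insert b S. (\<Sum>\<beta>\<in>insert b S. poly (C \<alpha> \<beta>) t * v \<beta>) = 0"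
      and t: "poly (C b b) t \<noteq> 0" for t v
  proof -
    have eq': "(\<Sum>\<beta>\<in>S. poly (C \<alpha> \<beta>) t * v \<beta>) = - (poly (C \<alpha> b) t * v b)" if "\<alpha> \<in> insert b S" for \<alpha>
      using eq[rule_format, OF that] insert.hyps by (simp add: eq_neg_iff_add_eq_0 add.commute)
    have "(\<Sum>\<beta>\<in>S. poly (C' \<alpha> \<beta>) t * v \<beta>) = 0" if "\<alpha> \<in> S" for \<alpha>
    proof -
      have "(\<Sum>\<beta>\<in>S. poly (C' \<alpha> \<beta>) t * v \<beta>) =
          poly (C b b) t * (\<Sum>\<beta>\<in>S. poly (C \<alpha> \<beta>) t * v \<beta>)
          - poly (C \<alpha> b) t * (\<Sum>\<beta>\<in>S. poly (C b \<beta>) t * v \<beta>)"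
        by (simp add: C'_def sum_distrib_left sum_subtractf algebra_simps)
      also have "\<dots> = 0"
        using that by (simp add: eq')
      finally show ?thesis .
    qed
    \<comment> \<open>If \<open>v\<close> vanished on \<open>S\<close>, row \<open>b\<close> would
      reduce to pivot times \<open>v b\<close> = 0, so \<open>v\<close> would vanish at
      \<open>b\<close> too.\<close>
    moreover have "\<exists>\<alpha>\<in>S. v \<alpha> \<noteq> 0"
    proof (rule ccontr)
      assume "\<not> ?thesis"
      then have "v b = 0"
        using eq'[of b] t by simp
      with \<open>\<not> ?thesis\<close> nz show False by auto
    qed
    ultimately show ?thesis
      unfolding bad_def by blast
  qed
  then have sub: "{t. \<exists>v. (\<exists>\<alpha>\<in>insert b S. v \<alpha> \<noteq> 0) \<and>
      (\<forall>\<alpha>\<in>insert b S. (\<Sum>\<beta>\<in>insert b S. poly (C \<alpha> \<beta>) t * v \<beta>) = 0)} \<subseteq> bad \<union> {t. poly (C b b) t = 0}"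
    by (intro subsetI UnCI) (elim CollectE exE conjE, simp)
  show ?case
    using \<open>finite bad\<close> fin by (rule finite_subset[OF sub finite_UnI])
qed

section \<open>Forms with coefficients polynomial in a parameter\<close>

definition exponents :: "nat \<Rightarrow> ('n::finite \<Rightarrow> nat) set"
  where "exponents d = {\<alpha>. sum \<alpha> UNIV = d}"

definition monomial :: "('n::finite \<Rightarrow> nat) \<Rightarrow> complex ^ 'n \<Rightarrow> complex"
  where "monomial \<alpha> x = (\<Prod>i\<in>UNIV. x $ i ^ \<alpha> i)"

text \<open>Homogeneous of degree \<open>d\<close> in the second argument, with coefficients polynomial in the first.\<close>

definition form :: "nat \<Rightarrow> (complex \<Rightarrow> complex ^ 'n::finite \<Rightarrow> complex) \<Rightarrow> bool"
  where "form d f \<longleftrightarrow> (\<exists>c. \<forall>t x. f t x = (\<Sum>\<alpha>\<in>exponents d. poly (c \<alpha>) t * monomial \<alpha> x))"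

lemma finite_exponents: "finite (exponents d :: ('n::finite \<Rightarrow> nat) set)"
proof (rule finite_subset)
  show "exponents d \<subseteq> (PiE UNIV (\<lambda>_. {..d}) :: ('n \<Rightarrow> nat) set)"
    by (auto simp: exponents_def PiE_def intro: member_le_sum)
qed (simp add: finite_PiE)

lemma monomial_add: "monomial (\<lambda>i. \<alpha> i + \<beta> i) x = monomial \<alpha> x * monomial \<beta> x"
  by (simp add: monomial_def power_add prod.distrib)

lemma form_monomial:
  assumes "\<alpha> \<in> exponents d"
  shows "form d (\<lambda>t x. poly p t * monomial \<alpha> x)"
  unfolding form_def
proof (intro exI allI)
  fix t x
  show "poly p t * monomial \<alpha> x =
      (\<Sum>\<beta>\<in>exponents d. poly (if \<beta> = \<alpha> then p else 0) t * monomial \<beta> x)"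
    using assms by (simp add: if_distrib[where f = "\<lambda>p. poly p t * _"] sum.delta finite_exponents cong: if_cong)
qed

lemma form_const: "form 0 (\<lambda>t x. poly p t)"
  using form_monomial[of "\<lambda>_. 0" 0 p] by (simp add: exponents_def monomial_def)

lemma monomial_single: "monomial (\<lambda>j. if j = i then k else 0) x = x $ i ^ k"
  by (simp add: monomial_def if_distrib[where f = "\<lambda>k. _ ^ k"] prod.delta cong: if_cong)

lemma form_component_power: "form k (\<lambda>t x. x $ i ^ k)"
  using form_monomial[of "\<lambda>j. if j = i then k else 0" k 1]
  by (simp add: exponents_def monomial_single sum.delta)

lemma form_zero: "form d (\<lambda>t x. 0)"
  unfolding form_def by (rule exI[of _ "\<lambda>_. 0"]) simp

lemma form_add:
  assumes "form d f" "form d g"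
  shows "form d (\<lambda>t x. f t x + g t x)"
proof -
  obtain a b where "\<And>t x. f t x = (\<Sum>\<alpha>\<in>exponents d. poly (a \<alpha>) t * monomial \<alpha> x)"
    "\<And>t x. g t x = (\<Sum>\<alpha>\<in>exponents d. poly (b \<alpha>) t * monomial \<alpha> x)"
    using assms unfolding form_def by blast
  then show ?thesis
    unfolding form_def
    by (intro exI[of _ "\<lambda>\<alpha>. a \<alpha> + b \<alpha>"]) (simp add: sum.distrib algebra_simps)
qed

lemma form_sum:
  assumes "\<And>i. i \<in> I \<Longrightarrow> form d (f i)"
  shows "form d (\<lambda>t x. \<Sum>i\<in>I. f i t x)"
  using assms
  by (induction I rule: infinite_finite_induct) (simp_all add: form_zero form_add)

lemma form_mult:
  assumes "form d f" "form e g"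
  shows "form (d + e) (\<lambda>t x. f t x * g t x)"
proof -
  obtain a b where a: "\<And>t x. f t x = (\<Sum>\<alpha>\<in>exponents d. poly (a \<alpha>) t * monomial \<alpha> x)"
    and b: "\<And>t x. g t x = (\<Sum>\<beta>\<in>exponents e. poly (b \<beta>) t * monomial \<beta> x)"
    using assms unfolding form_def by blast
  have "f t x * g t x =
      (\<Sum>\<alpha>\<in>exponents d. \<Sum>\<beta>\<in>exponents e. poly (a \<alpha> * b \<beta>) t * monomial (\<lambda>i. \<alpha> i + \<beta> i) x)" for t x
    by (simp add: a b sum_product monomial_add mult_ac)
  moreover have "form (d + e) (\<lambda>t x. \<Sum>\<alpha>\<in>exponents d. \<Sum>\<beta>\<in>exponents e.
      poly (a \<alpha> * b \<beta>) t * monomial (\<lambda>i. \<alpha> i + \<beta> i) x)"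
    by (intro form_sum form_monomial) (simp add: exponents_def sum.distrib)
  ultimately show ?thesis
    by simp
qed

text \<open>Each coefficient \<open>c\<close> satisfies c(t) = c(s) + (t - s) q(t), with
  \<open>q\<close> obtained by synthetic division at \<open>s\<close>.\<close>

lemma form_divide_difference:
  assumes "form d f"
  obtains h where "form d h" "\<And>t x. f t x = f s x + (t - s) * h t x"
proof -
  obtain c where c: "\<And>t x. f t x = (\<Sum>\<alpha>\<in>exponents d. poly (c \<alpha>) t * monomial \<alpha> x)"
    using assms unfolding form_def by blast
  define h where "h t x = (\<Sum>\<alpha>\<in>exponents d. poly (synthetic_div (c \<alpha>) s) t * monomial \<alpha> x)" for t x
  have "poly (c \<alpha>) t = poly (c \<alpha>) s + (t - s) * poly (synthetic_div (c \<alpha>) s) t" for \<alpha> t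
    using arg_cong[OF synthetic_div_correct'[of s "c \<alpha>"], of "\<lambda>p. poly p t"]
    by (simp add: algebra_simps)
  then have "f t x = f s x + (t - s) * h t x" for t x
    unfolding c h_def sum_distrib_left sum.distrib[symmetric]
    by (intro sum.cong refl) (metis distrib_right mult.assoc)
  moreover have "form d h"
    unfolding form_def h_def by (intro exI[of _ "\<lambda>\<alpha>. synthetic_div (c \<alpha>) s"]) simp
  ultimately show thesis
    by (intro that)
qed

lemma finite_nontrivial_common_zero:
  fixes f :: "'n::finite \<Rightarrow> complex \<Rightarrow> complex ^ 'n \<Rightarrow> complex"
  assumes form: "\<And>i. form d (f i)"
    and at_s: "\<And>i x. f i s x = x $ i ^ d"
  shows "finite {t. \<exists>x. x \<noteq> 0 \<and> (\<forall>i. f i t x = 0)}"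
proof -
  \<comment> \<open>A monomial of degree \<open>N\<close> is divisible by some \<open>x\<^sub>i\<^sup>d\<close>; replacing this factor by \<open>f\<^sub>i\<close> expresses
    elements of the ideal through a square matrix \<open>C\<close> over the monomials that is the identity at \<open>s\<close>.\<close>
  define N where "N = CARD('n) * d"
  define E where "E = (exponents N :: ('n \<Rightarrow> nat) set)"
  have "\<exists>h. form d h \<and> (\<forall>t x. f i t x = x $ i ^ d + (t - s) * h t x)" for i
    by (rule form_divide_difference[OF form[of i], of s]) (auto simp: at_s)
  then obtain h where h: "\<And>i. form d (h i)"
    and f: "\<And>i t x. f i t x = x $ i ^ d + (t - s) * h i t x"
    by metis
  \<comment> \<open>Pigeonhole: exponents that are all below \<open>d\<close> would add up to less
    than \<open>N\<close>.\<close>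
  have "\<exists>i. d \<le> \<alpha> i" if "\<alpha> \<in> E" for \<alpha>
  proof (rule ccontr)
    assume "\<not> ?thesis"
    then have "sum \<alpha> UNIV < (\<Sum>i\<in>(UNIV::'n set). d)"
      by (intro sum_strict_mono) (auto simp: not_le)
    then show False
      using that by (simp add: E_def exponents_def N_def)
  qed
  then obtain \<iota> where \<iota>: "\<And>\<alpha>. \<alpha> \<in> E \<Longrightarrow> d \<le> \<alpha> (\<iota> \<alpha>)"
    by metis
  define \<rho> where "\<rho> \<alpha> = \<alpha>(\<iota> \<alpha> := \<alpha> (\<iota> \<alpha>) - d)" for \<alpha>
  have split: "\<alpha> = (\<lambda>j. \<rho> \<alpha> j + (if j = \<iota> \<alpha> then d else 0))" if "\<alpha> \<in> E" for \<alpha>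
    using \<iota>[OF that] by (auto simp: \<rho>_def)
  have mono: "monomial \<alpha> x = monomial (\<rho> \<alpha>) x * x $ \<iota> \<alpha> ^ d" if "\<alpha> \<in> E" for \<alpha> x
    by (subst split[OF that]) (simp only: monomial_add monomial_single)
  \<comment> \<open>The quotient monomial has degree N - d and \<open>h\<close> has degree
    \<open>d\<close>, so their product is again a combination of the monomials in \<open>E\<close>.
    This makes \<open>C\<close> square.\<close>
  have "\<exists>c. \<forall>t x. monomial (\<rho> \<alpha>) x * h (\<iota> \<alpha>) t x = (\<Sum>\<beta>\<in>E. poly (c \<beta>) t * monomial \<beta> x)"
    if "\<alpha> \<in> E" for \<alpha>
  proof -
    have "sum \<alpha> UNIV = sum (\<rho> \<alpha>) UNIV + d"
      by (subst split[OF that]) (simp add: sum.distrib)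
    then have N: "sum (\<rho> \<alpha>) UNIV + d = N"
      using that by (simp add: E_def exponents_def)
    have "form (sum (\<rho> \<alpha>) UNIV) (\<lambda>t x. monomial (\<rho> \<alpha>) x)"
      using form_monomial[of "\<rho> \<alpha>" _ 1] by (simp add: exponents_def)
    from form_mult[OF this h[of "\<iota> \<alpha>"]] show ?thesis
      unfolding N form_def E_def .
  qed
  then obtain c where c: "\<And>\<alpha> t x. \<alpha> \<in> E \<Longrightarrow>
      monomial (\<rho> \<alpha>) x * h (\<iota> \<alpha>) t x = (\<Sum>\<beta>\<in>E. poly (c \<alpha> \<beta>) t * monomial \<beta> x)"
    by metis
  define C where "C \<alpha> \<beta> = (if \<alpha> = \<beta> then 1 else 0) + [:-s, 1:] * c \<alpha> \<beta>" for \<alpha> \<beta>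
  have C: "(\<Sum>\<beta>\<in>E. poly (C \<alpha> \<beta>) t * monomial \<beta> x) = monomial (\<rho> \<alpha>) x * f (\<iota> \<alpha>) t x"
    if "\<alpha> \<in> E" for \<alpha> t x
  proof -
    have "(\<Sum>\<beta>\<in>E. poly (C \<alpha> \<beta>) t * monomial \<beta> x) =
        (\<Sum>\<beta>\<in>E. if \<alpha> = \<beta> then monomial \<beta> x else 0) + (t - s) * (\<Sum>\<beta>\<in>E. poly (c \<alpha> \<beta>) t * monomial \<beta> x)"
      unfolding sum_distrib_left sum.distrib[symmetric]
      by (intro sum.cong) (auto simp: C_def algebra_simps)
    also have "\<dots> = monomial \<alpha> x + (t - s) * (monomial (\<rho> \<alpha>) x * h (\<iota> \<alpha>) t x)"
      using that by (simp add: c E_def finite_exponents)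
    also have "\<dots> = monomial (\<rho> \<alpha>) x * f (\<iota> \<alpha>) t x"
      by (simp add: mono[OF that] f algebra_simps)
    finally show ?thesis .
  qed
  let ?bad = "{t. \<exists>v. (\<exists>\<alpha>\<in>E. v \<alpha> \<noteq> 0) \<and> (\<forall>\<alpha>\<in>E. (\<Sum>\<beta>\<in>E. poly (C \<alpha> \<beta>) t * v \<beta>) = 0)}"
  have "finite ?bad"
    by (rule finite_poly_matrix_singular[where s = s]) (auto simp: E_def finite_exponents C_def)
  \<comment> \<open>The values at \<open>x\<close> of all monomials of degree \<open>N\<close> form
    a kernel vector of \<open>C\<close>; it is nonzero because it contains a power of a nonzero
    coordinate.\<close>
  have "t \<in> ?bad" if "x \<noteq> 0" "\<forall>i. f i t x = 0" for t x
  proof -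
    from \<open>x \<noteq> 0\<close> obtain i where "x $ i \<noteq> 0"
      by (auto simp: vec_eq_iff)
    then have "\<exists>\<alpha>\<in>E. monomial \<alpha> x \<noteq> 0"
      by (intro bexI[of _ "\<lambda>j. if j = i then N else 0"]) (simp_all add: monomial_single E_def exponents_def)
    moreover have "\<forall>\<alpha>\<in>E. (\<Sum>\<beta>\<in>E. poly (C \<alpha> \<beta>) t * monomial \<beta> x) = 0"
      using that by (simp add: C)
    ultimately show ?thesis
      by (intro CollectI exI conjI)
  qed
  then have "{t. \<exists>x. x \<noteq> 0 \<and> (\<forall>i. f i t x = 0)} \<subseteq> ?bad"
    by (intro subsetI) (elim CollectE exE conjE)
  then show ?thesis
    using \<open>finite ?bad\<close> by (rule finite_subset)
qed

section \<open>Linear algebra\<close>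

text \<open>Split off a root: q = (X - c) p. Then w = p(M) v satisfies M w = c w. If c is nonzero, w
  = 0 and the induction hypothesis applies to \<open>p\<close> and \<open>v\<close>; if c = 0, then
  p(M) kills M v and it applies to \<open>p\<close> and M v. A nonzero constant \<open>q\<close>
  forces v = 0.\<close>

lemma funpow_killed_if_poly_killed:
  fixes M :: "complex ^ 'n ^ 'n"
  assumes eig: "\<And>c w. c \<noteq> 0 \<Longrightarrow> M *v w = c *s w \<Longrightarrow> w = 0"
    and "q \<noteq> 0" "degree q \<le> m"
    and "(\<Sum>i\<le>m. coeff q i *s (((*v) M ^^ i) v)) = 0"
  shows "((*v) M ^^ m) v = 0"
  using assms(2-)
proof (induction m arbitrary: q v)
  case 0
  then show ?case
    using leading_coeff_0_iff[of q] by auto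
next
  case (Suc m)
  show ?case
  proof (cases "degree q = 0")
    case True
    then obtain a where q: "q = [:a:]"
      by (rule degree_eq_zeroE)
    have "(\<Sum>i\<le>Suc m. coeff q i *s (((*v) M ^^ i) v)) = (\<Sum>i\<in>{0}. coeff q i *s (((*v) M ^^ i) v))"
      by (intro sum.mono_neutral_right) (auto simp: q coeff_pCons split: nat.splits)
    with Suc.prems q have "v = 0"
      by simp
    then have "((*v) M ^^ k) v = 0" for k
      by (induction k) simp_all
    then show ?thesis .
  next
    case False
    then obtain c where "poly q c = 0"
      using fundamental_theorem_of_algebra constant_degree by metis
    then obtain p where q: "q = [:-c, 1:] * p"
      by (metis dvdE poly_eq_0_iff_dvd)
    have "p \<noteq> 0"
      using Suc.prems(1) q by auto
    then have "degree q = Suc (degree p)"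
      unfolding q by (subst degree_mult_eq) auto
    with \<open>p \<noteq> 0\<close> have p: "p \<noteq> 0" "degree p \<le> m"
      using Suc.prems(2) by simp_all
    define w where "w = (\<Sum>i\<le>m. coeff p i *s (((*v) M ^^ i) v))"
    have Mw: "M *v w = (\<Sum>i\<le>m. coeff p i *s (((*v) M ^^ Suc i) v))"
      by (simp add: w_def vec.sum vec.scale)
    have coeff: "coeff q i = (case i of 0 \<Rightarrow> 0 | Suc k \<Rightarrow> coeff p k) - c * coeff p i" for i
      by (simp add: q coeff_pCons)
    have "0 = (\<Sum>i\<le>Suc m. (case i of 0 \<Rightarrow> 0 | Suc k \<Rightarrow> coeff p k) *s (((*v) M ^^ i) v))
        - (\<Sum>i\<le>Suc m. (c * coeff p i) *s (((*v) M ^^ i) v))"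
      using Suc.prems(3) by (simp only: coeff vec.scale_left_diff_distrib sum_subtractf)
    also have "(\<Sum>i\<le>Suc m. (case i of 0 \<Rightarrow> 0 | Suc k \<Rightarrow> coeff p k) *s (((*v) M ^^ i) v)) = M *v w"
      unfolding Mw sum.atMost_Suc_shift by simp
    also have "(\<Sum>i\<le>Suc m. (c * coeff p i) *s (((*v) M ^^ i) v)) = c *s w"
      using p(2) by (simp add: w_def coeff_eq_0 vec.scale_sum_right)
    finally have Mwc: "M *v w = c *s w"
      by simp
    show ?thesis
    proof (cases "c = 0")
      case True
      then have "(\<Sum>i\<le>m. coeff p i *s (((*v) M ^^ i) (M *v v))) = 0"
        using Mw Mwc by (simp add: funpow_swap1)
      from Suc.IH[OF p this] show ?thesis
        by (simp add: funpow_swap1)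
    next
      case False
      with eig Mwc have "w = 0"
        by blast
      with Suc.IH[OF p, of v] show ?thesis
        by (simp add: w_def)
    qed
  qed
qed

text \<open>The n + 1 vectors u 0, ..., u n in dimension n are linearly dependent; the coefficients
  of a relation become those of \<open>q\<close>.\<close>

lemma ex_poly_killing:
  fixes u :: "nat \<Rightarrow> complex ^ 'n"
  shows "\<exists>q. q \<noteq> 0 \<and> degree q \<le> CARD('n) \<and> (\<Sum>i\<le>CARD('n). coeff q i *s u i) = 0"
proof -
  define m where "m = CARD('n)"
  have "\<exists>c. (\<exists>i\<le>m. c i \<noteq> 0) \<and> (\<Sum>i\<le>m. c i *s u i) = 0"
  proof (cases "inj_on u {..m}")
    case True
    have "vec.dependent (u ` {..m})"
    proof (rule ccontr)
      assume "vec.independent (u ` {..m})"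
      then have "card (u ` {..m}) \<le> vec.dim (UNIV :: (complex ^ 'n) set)"
        by (intro vec.independent_card_le_dim) auto
      then show False
        using True by (simp add: card_image m_def card_cart_basis)
    qed
    then obtain a where a: "\<exists>v\<in>u ` {..m}. a v \<noteq> 0" "(\<Sum>v\<in>u ` {..m}. a v *s v) = 0"
      using vec.dependent_finite[of "u ` {..m}"] by auto
    then show ?thesis
      using True by (intro exI[of _ "a \<circ> u"]) (auto simp: sum.reindex)
  \<comment> \<open>Dependence is a property of sets and does not see repetitions, so two equal
    members of the family give the relation u i - u j = 0 directly.\<close>
  next
    case False
    then obtain i j where ij: "i \<le> m" "j \<le> m" "i \<noteq> j" "u i = u j"
      by (auto simp: inj_on_def)
    have "(\<Sum>k\<le>m. (if k = i then 1 else if k = j then -1 else 0) *s u k)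
        = (\<Sum>k\<le>m. (if k = i then u k else 0) - (if k = j then u k else 0))"
      using ij by (intro sum.cong) auto
    also have "\<dots> = 0"
      using ij by (simp add: sum_subtractf)
    finally show ?thesis
      using ij by (intro exI[of _ "\<lambda>k. if k = i then 1 else if k = j then -1 else 0"]) auto
  qed
  then obtain c i where c: "i \<le> m" "c i \<noteq> 0" "(\<Sum>i\<le>m. c i *s u i) = 0"
    by blast
  define q where "q = (\<Sum>i\<le>m. monom (c i) i)"
  have coeff: "coeff q k = (if k \<le> m then c k else 0)" for k
    by (simp add: q_def coeff_sum)
  have "q \<noteq> 0"
    using c coeff[of i] by auto
  moreover have "degree q \<le> m"
    by (rule degree_le) (simp add: coeff)
  moreover have "(\<Sum>i\<le>m. coeff q i *s u i) = 0"
    using c(3) by (simp add: coeff)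
  ultimately show ?thesis
    unfolding m_def by blast
qed

text \<open>Iterates \<open>**\<close>, since \<open>^\<close> on nested vectors acts
  entrywise.\<close>

definition matrix_power :: "complex ^ 'n ^ 'n \<Rightarrow> nat \<Rightarrow> complex ^ 'n ^ 'n"
  where "matrix_power M k = ((**) M ^^ k) (mat 1)"

lemma matrix_power_0: "matrix_power M 0 = mat 1"
  and matrix_power_Suc: "matrix_power M (Suc k) = M ** matrix_power M k"
  by (simp_all add: matrix_power_def)

lemma matrix_power_vector_mult: "matrix_power M k *v v = ((*v) M ^^ k) v"
  by (induction k) (simp_all add: matrix_power_0 matrix_power_Suc flip: matrix_vector_mul_assoc)

text \<open>An eigenvalue c other than 0 would make Id + s M singular at s = -1/c. So 0 is the only
  eigenvalue, and every vector, being killed by a polynomial in \<open>M\<close> of degree at most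
  n, is killed by the n-th power of \<open>M\<close>.\<close>

lemma nilpotent_if_det_eq_1:
  fixes M :: "complex ^ 'n ^ 'n"
  assumes det: "\<And>s. det (\<chi> i j. (if i = j then 1 else 0) + s * M $ i $ j) = 1"
  shows "matrix_power M CARD('n) = 0"
proof -
  have eig: "w = 0" if "c \<noteq> 0" "M *v w = c *s w" for c w
  proof -
    define X where "X = (\<chi> i j. (if i = j then 1 else 0) + (- 1 / c) * M $ i $ j)"
    have "X *v w = w + (- 1 / c) *s (M *v w)"
    proof -
      have "(X *v w) $ i = (\<Sum>j\<in>UNIV. (if i = j then w $ j else 0) + (- 1 / c) * (M $ i $ j * w $ j))" for i
        unfolding X_def matrix_vector_mult_def by (auto intro!: sum.cong simp: algebra_simps)
      then show ?thesis
        by (simp add: vec_eq_iff matrix_vector_mult_def sum.distrib sum_subtractf sum_divide_distrib)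
    qed
    also have "\<dots> = 0"
      using that by (simp add: vec_eq_iff)
    finally have "X *v w = 0" .
    moreover have "invertible X"
      unfolding invertible_det_nz X_def by (simp only: det) simp
    ultimately show ?thesis
      by (metis invertible_left_inverse matrix_left_invertible_ker)
  qed
  have "matrix_power M CARD('n) *v v = 0" for v
  proof -
    obtain q where "q \<noteq> 0" "degree q \<le> CARD('n)" "(\<Sum>i\<le>CARD('n). coeff q i *s (((*v) M ^^ i) v)) = 0"
      using ex_poly_killing[of "\<lambda>i. ((*v) M ^^ i) v"] by auto
    from funpow_killed_if_poly_killed[OF eig this] show ?thesis
      unfolding matrix_power_vector_mult .
  qed
  then show ?thesis
    by (simp add: matrix_eq)
qed

section \<open>Rank and the rank normal form\<close>

text \<open>Rows of \<open>B ** A\<close> are combinations of rows of \<open>A\<close>; rows of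
  \<open>A ** C\<close> are the images of the rows of \<open>A\<close> under the transpose of
  \<open>C\<close>.\<close>

lemma rank_mult_le:
  fixes A :: "'a::field ^ 'n ^ 'm"
  shows rank_mult_le_right: "rank (B ** A) \<le> rank A"
    and rank_mult_le_left: "rank (A ** C) \<le> rank A"
proof -
  have "rows (B ** A) \<subseteq> vec.span (rows A)"
  proof
    fix x assume "x \<in> rows (B ** A)"
    then obtain i where "x = row i (B ** A)"
      by (auto simp: rows_def)
    also have "\<dots> = (\<Sum>k\<in>UNIV. B $ i $ k *s row k A)"
      by (simp add: row_def vec_eq_iff matrix_matrix_mult_def)
    also have "\<dots> \<in> vec.span (rows A)"
      by (intro vec.span_sum vec.span_scale vec.span_base) (auto simp: rows_def)
    finally show "x \<in> vec.span (rows A)" .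
  qed
  then show "rank (B ** A) \<le> rank A"
    unfolding row_rank_def_gen by (metis vec.dim_span vec.dim_subset)
  have "row i (A ** C) = transpose C *v row i A" for i
    by (simp add: row_def vec_eq_iff matrix_matrix_mult_def matrix_vector_mult_def transpose_def mult.commute)
  then have "rows (A ** C) = (*v) (transpose C) ` rows A"
    by (auto simp: rows_def)
  then show "rank (A ** C) \<le> rank A"
    unfolding row_rank_def_gen by (metis matrix_vector_mul_linear_gen vec.dim_image_le)
qed

lemma rank_mult_invertible:
  fixes A :: "'a::field ^ 'n ^ 'm"
  assumes "invertible B" "invertible C"
  shows "rank (B ** A ** C) = rank A"
proof (rule antisym)
  show "rank (B ** A ** C) \<le> rank A"
    by (meson order_trans rank_mult_le_left rank_mult_le_right)
  obtain B' C' where "B' ** B = mat 1" "C ** C' = mat 1"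
    using assms unfolding invertible_def by blast
  then have "A = B' ** (B ** A ** C) ** C'"
    by (metis matrix_mul_assoc matrix_mul_lid matrix_mul_rid)
  then show "rank A \<le> rank (B ** A ** C)"
    by (metis order_trans rank_mult_le_left rank_mult_le_right)
qed

text \<open>The coordinates of a common vector with respect to \<open>B\<close> are supported in
  both \<open>C\<close> and \<open>D\<close>, hence all zero.\<close>

lemma span_Int_span_disjoint:
  fixes B :: "('a::field ^ 'n) set"
  assumes "vec.independent B" "C \<subseteq> B" "D \<subseteq> B" "C \<inter> D = {}"
  shows "vec.span C \<inter> vec.span D = {0}"
proof -
  have "x = 0" if x: "x \<in> vec.span C" "x \<in> vec.span D" for x
  proof -
    have "vec.representation B x b = 0" for b
      using vec.representation_extend[OF assms(1) x(1) assms(2)]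
        vec.representation_extend[OF assms(1) x(2) assms(3)]
        vec.representation_ne_zero[of C x b] vec.representation_ne_zero[of D x b] assms(4)
      by auto
    moreover have "x \<in> vec.span B"
      using x(1) assms(2) vec.span_mono by blast
    ultimately show ?thesis
      using vec.sum_nonzero_representation_eq[OF assms(1), of x] by simp
  qed
  then show ?thesis
    using vec.span_zero by auto
qed

text \<open>Extend a basis \<open>B0\<close> of the kernel to a basis \<open>B\<close>. On the span
  of \<open>B - B0\<close> the map \<open>A\<close> is injective, so its values on
  \<open>B - B0\<close> extend to an injective linear map \<open>g\<close> of the whole space. With
  \<open>P\<close> having the vectors of \<open>B\<close> as columns, \<open>G\<close> is the matrix
  of \<open>g\<close> times \<open>P\<close>, and \<open>H\<close> is the inverse of
  \<open>P\<close>.\<close>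

lemma rank_normal_form:
  fixes A :: "'a::field ^ 'n ^ 'n"
  obtains G H :: "'a ^ 'n ^ 'n" and S :: "'n set" where "invertible G" "invertible H"
    "A = G ** diag_matrix (\<chi> i. if i \<in> S then 1 else 0) ** H"
proof -
  define K where "K = {x. A *v x = 0}"
  obtain B0 where B0: "B0 \<subseteq> K" "vec.independent B0" "K \<subseteq> vec.span B0"
    using vec.basis_exists[of K] by metis
  obtain B where B: "B0 \<subseteq> B" "vec.independent B" "UNIV \<subseteq> vec.span B"
    using vec.maximal_independent_subset_extend[of B0 UNIV] B0(2) by auto
  have "finite B"
    using B(2) by (rule vec.finiteI_independent)
  have "vec.independent (B - B0)"
    using B(2) by (rule vec.independent_mono) auto
  have inj: "x = 0" if "x \<in> vec.span (B - B0)" "A *v x = 0" for x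
  proof -
    have "x \<in> vec.span B0"
      using that(2) B0(3) by (auto simp: K_def)
    moreover have "vec.span (B - B0) \<inter> vec.span B0 = {0}"
      using B by (intro span_Int_span_disjoint) auto
    ultimately show ?thesis
      using that(1) by blast
  qed
  have inj_on: "inj_on ((*v) A) (vec.span (B - B0))"
    using inj by (metis vec.inj_on_iff_eq_0 vec.subspace_span vec.linear_axioms)
  have "vec.independent ((*v) A ` (B - B0))"
    using inj_on \<open>vec.independent (B - B0)\<close> vec.independent_injective_image by blast
  then obtain g where g: "Vector_Spaces.linear (*s) (*s) g" "inj g" "\<forall>x\<in>B - B0. g x = A *v x"
    using vec.linear_independent_extend_inj[OF \<open>vec.independent (B - B0)\<close>] inj_on
    by (metis inj_on_subset vec.span_superset)
  have "card B = CARD('n)"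
    using B by (metis card_cart_basis vec.dim_UNIV vec.basis_card_eq_dim subset_UNIV)
  then obtain \<phi> :: "'n \<Rightarrow> 'a ^ 'n" where \<phi>: "bij_betw \<phi> UNIV B"
    using \<open>finite B\<close> finite_same_card_bij[of "UNIV :: 'n set" B] by auto
  define S where "S = \<phi> -` (B - B0)"
  define P where "P = (\<chi> i j. \<phi> j $ i)"
  define G where "G = matrix g ** P"
  have P: "P *v axis i 1 = \<phi> i" for i
    by (simp add: P_def matrix_vector_mult_def axis_def vec_eq_iff if_distrib cong: if_cong)
  have "surj ((*v) P)"
  proof -
    have "B \<subseteq> range ((*v) P)"
      using P \<phi> by (metis (no_types, lifting) bij_betw_imp_surj_on image_subset_iff rangeI)
    then have "vec.span B \<subseteq> range ((*v) P)"
      by (intro vec.span_minimal vec.subspace_image vec.subspace_UNIV)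
    with B(3) show ?thesis by auto
  qed
  then have "invertible P"
    by (metis invertible_right_inverse matrix_right_invertible_surjective)
  have g_eq: "matrix g *v x = g x" for x
    using g(1) by (rule matrix_works)
  then have "inj ((*v) (matrix g))"
    using g(2) by (simp add: inj_on_def)
  then have "invertible (matrix g)"
    by (metis invertible_left_inverse matrix_left_invertible_injective)
  then have "invertible G"
    unfolding G_def using \<open>invertible P\<close> by (rule invertible_mult)
  let ?D = "diag_matrix (\<chi> i. if i \<in> S then 1 else 0) :: 'a ^ 'n ^ 'n"
  have D: "?D *v axis i 1 = (if i \<in> S then axis i 1 else 0)" for i
    by (auto simp: diag_matrix_def matrix_vector_mult_def axis_def vec_eq_iff if_distrib cong: if_cong)
  \<comment> \<open>Compare columns: basis vectors indexed by \<open>S\<close> are mapped alike by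
    \<open>A\<close> and \<open>g\<close>, the others lie in the kernel of \<open>A\<close>.\<close>
  have "(A ** P) *v axis i 1 = (G ** ?D) *v axis i 1" for i
  proof (cases "i \<in> S")
    case True
    then have "g (\<phi> i) = A *v \<phi> i"
      using g(3) by (simp add: S_def)
    with True show ?thesis
      by (simp add: P D G_def g_eq flip: matrix_vector_mul_assoc)
  next
    case False
    then have "\<phi> i \<in> K"
      using B0(1) \<phi> by (auto simp: S_def bij_betw_def)
    with False show ?thesis
      by (simp add: P D K_def flip: matrix_vector_mul_assoc)
  qed
  then have "A ** P = G ** ?D"
    by (simp add: matrix_vector_mult_def axis_def vec_eq_iff if_distrib cong: if_cong)
  moreover obtain H where "P ** H = mat 1" "H ** P = mat 1"
    using \<open>invertible P\<close> unfolding invertible_def by blast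
  ultimately have "A = G ** ?D ** H" "invertible H"
    by (metis matrix_mul_assoc matrix_mul_rid, auto simp: invertible_def)
  then show thesis
    by (intro that[OF \<open>invertible G\<close>])
qed

section \<open>Condition C1\<close>

text \<open>The matrix in the conclusion is Delta[z^2] A.\<close>

lemma nilpotent_if_V:
  assumes "(y, z, A) \<in> V"
  shows "matrix_power (\<chi> i j. z $ i ^ 2 * A $ i $ j) CARD('n) = (0 :: complex ^ 'n ^ 'n)"
proof (rule nilpotent_if_det_eq_1)
  fix s :: complex
  \<comment> \<open>Coefficient 0 at \<open>y\<close> and a square root of \<open>s\<close> at
    \<open>z\<close> turn the determinant condition into det(Id + s Delta[z^2] A) = 1.\<close>
  have "mat 1 + diag_matrix ((csqrt s *s z + 0 *s y) ^ 2) ** A =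
      (\<chi> i j. (if i = j then 1 else 0) + s * (\<chi> i j. z $ i ^ 2 * A $ i $ j) $ i $ j)"
  proof -
    have "(\<Sum>k\<in>UNIV. (if i = k then (csqrt s * z $ i) ^ 2 else 0) * A $ k $ j) = s * (z $ i ^ 2 * A $ i $ j)" for i j
      by (simp add: if_distrib[where f = "\<lambda>a. a * _"] power_mult_distrib mult.assoc cong: if_cong)
    then show ?thesis
      by (simp add: vec_eq_iff mat_def diag_matrix_def matrix_matrix_mult_def power2_eq_square cong: if_cong)
  qed
  moreover have "det (mat 1 + diag_matrix ((csqrt s *s z + 0 *s y) ^ 2) ** A) = 1"
    using assms unfolding V_def by blast
  ultimately show "det (\<chi> i j. (if i = j then 1 else 0) + s * (\<chi> i j. z $ i ^ 2 * A $ i $ j) $ i $ j) = 1"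
    by (simp only:)
qed

section \<open>Deformation to the identity and finiteness of the exceptional parameters\<close>

text \<open>The line runs from \<open>G\<close> at t = 0 to the identity at t = 1, and its entries
  are polynomials in t.\<close>

definition to_identity :: "complex ^ 'n ^ 'n \<Rightarrow> complex \<Rightarrow> complex ^ 'n ^ 'n"
  where "to_identity G t = (\<chi> i j. (1 - t) * G $ i $ j + t * mat 1 $ i $ j)"

lemma to_identity_1 [simp]: "to_identity G 1 = mat 1"
  by (simp add: to_identity_def vec_eq_iff)

lemma tendsto_to_identity: "(to_identity G \<longlongrightarrow> G) (at 0)"
proof (intro vec_tendstoI)
  fix i j
  have "((\<lambda>t. (1 - t) * G $ i $ j + t * mat 1 $ i $ j) \<longlongrightarrow> (1 - 0) * G $ i $ j + 0 * mat 1 $ i $ j) (at 0)"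
    by (intro tendsto_intros)
  then show "((\<lambda>t. to_identity G t $ i $ j) \<longlongrightarrow> G $ i $ j) (at 0)"
    by (simp add: to_identity_def)
qed

lemma eventually_invertible_to_identity:
  assumes "invertible G"
  shows "eventually (\<lambda>t. invertible (to_identity G t)) (at 0)"
proof -
  have "((\<lambda>t. det (to_identity G t)) \<longlongrightarrow> det G) (at 0)"
    unfolding det_def by (intro tendsto_intros tendsto_to_identity)
  moreover have "det G \<noteq> 0"
    using assms invertible_det_nz by blast
  ultimately show ?thesis
    unfolding invertible_det_nz by (rule tendsto_imp_eventually_ne)
qed

lemma form_to_identity: "form 0 (\<lambda>t x. to_identity G t $ i $ j)"
  using form_const[of "[:G $ i $ j, mat 1 $ i $ j - G $ i $ j:]"]
  by (simp add: to_identity_def algebra_simps)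

lemma form_matrix_mult:
  assumes "\<And>i j. form d (\<lambda>t x. M t x $ i $ j)" "\<And>i j. form e (\<lambda>t x. N t x $ i $ j)"
  shows "form (d + e) (\<lambda>t x. (M t x ** N t x) $ i $ j)"
  unfolding matrix_matrix_mult_def by (simp add: form_sum form_mult assms)

lemma form_matrix_power:
  assumes "\<And>i j. form d (\<lambda>t x. M t x $ i $ j)"
  shows "form (k * d) (\<lambda>t x. matrix_power (M t x) k $ i $ j)"
proof (induction k arbitrary: i j)
  case 0
  show ?case
    using form_const[of "[:mat 1 $ i $ j:]"] by (simp add: matrix_power_0)
next
  case (Suc k)
  show ?case
    using form_matrix_mult[OF assms Suc.IH] by (simp add: matrix_power_Suc)
qed

lemma matrix_power_diag:
  "matrix_power (diag_matrix u) k = diag_matrix (\<chi> i. u $ i ^ k)"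
proof (induction k)
  case 0
  then show ?case
    by (simp add: matrix_power_0 diag_matrix_def mat_def vec_eq_iff)
next
  case (Suc k)
  then show ?case
    by (simp add: matrix_power_Suc diag_matrix_def matrix_matrix_mult_def vec_eq_iff
        if_distrib[where f = "\<lambda>a. a * _"] cong: if_cong)
qed

lemma finite_not_condition_C1:
  fixes G H :: "complex ^ 'n ^ 'n" and S :: "'n set"
  defines "D \<equiv> diag_matrix (\<chi> i. if i \<in> S then 1 else 0)"
  defines "A \<equiv> \<lambda>t. to_identity G t ** D ** to_identity H t"
  shows "finite {t. \<not> condition_C1 (A t)}"
proof -
  define M where "M t x = (\<chi> i j. (to_identity G t *v x) $ i ^ 2 * A t $ i $ j)" for t and x :: "complex ^ 'n"
  \<comment> \<open>For \<open>i\<close> outside \<open>S\<close> the pure power completes the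
    family to one form per coordinate; it vanishes at the vectors of interest, which are supported
    in \<open>S\<close>. The degree 2n comes from the n-th power of a matrix with entries quadratic
    in \<open>x\<close>.\<close>
  define f where "f i t x = (if i \<in> S then matrix_power (M t x) CARD('n) $ i $ i else x $ i ^ (CARD('n) * 2))"
    for i t x
  have form_A: "form 0 (\<lambda>t x. A t $ i $ j)" for i j
    unfolding A_def using form_const[of "[:D $ _ $ _:]"]
    by (auto intro!: form_matrix_mult[of 0 _ 0, simplified] form_to_identity)
  have "form 1 (\<lambda>t x. (to_identity G t *v x) $ i)" for i
    unfolding matrix_vector_mult_def
    using form_mult[OF form_to_identity form_component_power[of 1]] by (auto intro!: form_sum)
  from form_mult[OF form_mult[OF this this] form_A]
  have form_M: "form 2 (\<lambda>t x. M t x $ i $ j)" for i j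
    by (simp add: M_def power2_eq_square numeral_2_eq_2)
  have D: "(D *v x) $ i = (if i \<in> S then x $ i else 0)" for x i
    by (simp add: D_def diag_matrix_def matrix_vector_mult_def if_distrib[where f = "\<lambda>a. a * _"] cong: if_cong)
  have "finite {t. \<exists>x. x \<noteq> 0 \<and> (\<forall>i. f i t x = 0)}"
  proof (rule finite_nontrivial_common_zero)
    show "form (CARD('n) * 2) (f i)" for i
      unfolding f_def using form_matrix_power[OF form_M] form_component_power by (cases "i \<in> S") auto
    \<comment> \<open>At t = 1 both lines have reached the identity, so \<open>A 1\<close> is
      \<open>D\<close>.\<close>
    have "M 1 x = diag_matrix (\<chi> i. if i \<in> S then x $ i ^ 2 else 0)" for x
      by (simp add: M_def A_def D_def diag_matrix_def vec_eq_iff)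
    then show "f i 1 x = x $ i ^ (CARD('n) * 2)" for i x
      by (simp add: f_def matrix_power_diag) (simp add: diag_matrix_def mult.commute flip: power_mult)
  qed
  moreover have "{t. \<not> condition_C1 (A t)} \<subseteq> {t. \<exists>x. x \<noteq> 0 \<and> (\<forall>i. f i t x = 0)}"
  proof
    fix t assume "t \<in> {t. \<not> condition_C1 (A t)}"
    then obtain y z where V: "(y, z, A t) \<in> V" and "z \<noteq> 0"
      by (auto simp: condition_C1_def)
    \<comment> \<open>The equation z = - A(z^3 + z*y^2) puts \<open>z\<close> in the image of
      \<open>A t\<close>; stripping off the left factor leaves a vector in the image of
      \<open>D\<close>.\<close>
    define x where "x = - (D *v (to_identity H t *v (z ^ 3 + z * y ^ 2)))"
    have "z = - (A t *v (z ^ 3 + z * y ^ 2))"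
      using V by (simp add: V_def eq_neg_iff_add_eq_0)
    also have "\<dots> = to_identity G t *v x"
      by (simp add: A_def x_def vec.neg flip: matrix_vector_mul_assoc)
    finally have z: "z = to_identity G t *v x" .
    have "matrix_power (M t x) CARD('n) = 0"
      using nilpotent_if_V[OF V] by (simp add: M_def z)
    then have "f i t x = 0" for i
      by (simp add: f_def) (simp add: x_def D)
    moreover have "x \<noteq> 0"
      using z \<open>z \<noteq> 0\<close> by auto
    ultimately show "t \<in> {t. \<exists>x. x \<noteq> 0 \<and> (\<forall>i. f i t x = 0)}"
      by blast
  qed
  ultimately show ?thesis
    by (rule rev_finite_subset)
qed

theorem mainTheorem12:
  fixes r :: nat
  assumes "1 \<le> r" and "r \<le> CARD('n::finite)"
  shows "{A :: complex ^ 'n ^ 'n. rank A = r}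
    \<subseteq> closure {A :: complex ^ 'n ^ 'n. rank A = r \<and> condition_C1 A}"
proof
  fix A :: "complex ^ 'n ^ 'n"
  assume "A \<in> {A. rank A = r}"
  then have r: "rank A = r" by simp
  obtain G H :: "complex ^ 'n ^ 'n" and S :: "'n set"
    where inv: "invertible G" "invertible H"
    and A: "A = G ** diag_matrix (\<chi> i. if i \<in> S then 1 else 0) ** H"
    by (rule rank_normal_form)
  define D where "D = (diag_matrix (\<chi> i. if i \<in> S then 1 else 0) :: complex ^ 'n ^ 'n)"
  define A' where "A' t = to_identity G t ** D ** to_identity H t" for t
  have "rank D = r"
    using rank_mult_invertible[OF inv] r by (simp add: A D_def)
  \<comment> \<open>A finite set does not accumulate at 0, so the exceptional parameters are avoided
    near 0.\<close>
  have "eventually (\<lambda>t. condition_C1 (A' t)) (at 0)"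
    using islimpt_finite[OF finite_not_condition_C1[of G S H], of 0]
    by (simp add: A'_def D_def islimpt_iff_eventually)
  moreover have "eventually (\<lambda>t. rank (A' t) = r) (at 0)"
    using eventually_invertible_to_identity[OF inv(1)] eventually_invertible_to_identity[OF inv(2)]
    by eventually_elim (simp add: A'_def rank_mult_invertible \<open>rank D = r\<close>)
  ultimately have "eventually (\<lambda>t. A' t \<in> closure {A. rank A = r \<and> condition_C1 A}) (at 0)"
    by eventually_elim (simp add: closure_subset[THEN subsetD])
  moreover have "(A' \<longlongrightarrow> A) (at 0)"
    unfolding A D_def[symmetric]
  proof (intro vec_tendstoI)
    fix i j
    show "((\<lambda>t. A' t $ i $ j) \<longlongrightarrow> (G ** D ** H) $ i $ j) (at 0)"
      unfolding A'_def matrix_matrix_mult_def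
      by (auto intro!: tendsto_intros tendsto_to_identity)
  qed
  \<comment> \<open>A limit of points of a closed set lies in that set.\<close>
  ultimately show "A \<in> closure {A. rank A = r \<and> condition_C1 A}"
    using Lim_in_closed_set[OF closed_closure _ at_neq_bot] by blast
qed

end
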